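(* Let $A\in Gl(d,\mathbb{R})$, $B\in\mathbb{R}^{d\times m}$, and let $U\subset\mathbb{R}^m$ be a convex compact neighborhood of $0$ with $U=\overline{\mathrm{int}\,U}$. For the control system $x_{k+1}=Ax_k+Bu_k$, $u_k\in U$, $k\in\mathbb{N}_0$, there exists a unique control set $D$ with nonvoid interior if and only if the system without control restriction is controllable in $\mathbb{R}^d$ (i.e. $\mathrm{rank}[B\ AB\ \cdots\ A^{d-1}B]=d$). In this case $0\in D_0\cap\mathrm{int}\,D$, where $D_0$ is the transitivity set of $D$.
   Context: $\mathbb{N}=\{1,2,\dots\}$, $\mathbb{N}_0=\{0,1,2,\dots\}$, $\mathcal{U}=U^{\mathbb{N}_0}$. For $x\in\mathbb{R}^d$, $u=(u_i)\in\mathcal{U}$ the solution is $\varphi(k,x,u)=A^kx+\sum_{i=0}^{k-1}A^{k-1-i}Bu_i$. Reachable and controllable sets: $\mathbf{R}(x)=\{\varphi(k,x,u)\mid k\in\mathbb{N},u\in\mathcal{U}\}$, $\mathbf{C}(x)=\{y\mid\exists k\in\mathbb{N},u\in\mathcal{U}:\varphi(k,y,u)=x\}$. A nonvoid set $D\subset\mathbb{R}^d$ is a control set if it is maximal (with respect to inclusion) with the properties: (i) $D\subset\overline{\mathbf{R}(x)}$ for all $x\in D$; (ii) for every $x\in D$ there is $u\in\mathcal{U}$ with $\varphi(k,x,u)\in D$ for all $k\in\mathbb{N}$. Its transitivity set is $D_0=\{z\in D\mid z\in\mathrm{int}\,\mathbf{C}(z)\}$. *)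

theory Defs
  imports "HOL-Analysis.Analysis"
begin

(* The operator ^ on real^'d^'d is the componentwise power, hence a separate matrix power. *)
primrec mat_pow :: "real^'d^'d \<Rightarrow> nat \<Rightarrow> real^'d^'d" where
  "mat_pow A 0 = mat 1"
| "mat_pow A (Suc k) = A ** mat_pow A k"

definition controls :: "(real^'m) set \<Rightarrow> (nat \<Rightarrow> real^'m) set" where
  "controls U = {u. \<forall>i. u i \<in> U}"

definition solution ::
  "real^'d^'d \<Rightarrow> real^'m^'d \<Rightarrow> nat \<Rightarrow> real^'d \<Rightarrow> (nat \<Rightarrow> real^'m) \<Rightarrow> real^'d" where
  "solution A B k x u =
     mat_pow A k *v x + (\<Sum>i<k. mat_pow A (k - 1 - i) *v (B *v u i))"

lemma solution_0: "solution A B 0 x u = x"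
  by (simp add: solution_def)

lemma solution_Suc: "solution A B (Suc k) x u = A *v solution A B k x u + B *v u k"
proof -
  have "A *v (mat_pow A (k - 1 - i) *v (B *v u i)) = mat_pow A (k - i) *v (B *v u i)"
    if "i < k" for i
  proof -
    have "k - i = Suc (k - 1 - i)" using that by simp
    then show ?thesis by (simp only: mat_pow.simps matrix_vector_mul_assoc matrix_mul_assoc)
  qed
  then have "A *v (\<Sum>i<k. mat_pow A (k - 1 - i) *v (B *v u i))
      = (\<Sum>i<k. mat_pow A (k - i) *v (B *v u i))"
    by (simp add: linear_sum[OF matrix_vector_mul_linear])
  then show ?thesis
    by (simp add: solution_def matrix_vector_right_distrib matrix_vector_mul_assoc)
qed

(* Positive times only (k >= 1): a point need not be reachable from itself. *)
definition reachable ::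
  "real^'d^'d \<Rightarrow> real^'m^'d \<Rightarrow> (real^'m) set \<Rightarrow> real^'d \<Rightarrow> (real^'d) set" where
  "reachable A B U x = {solution A B k x u | k u. 1 \<le> k \<and> u \<in> controls U}"

definition controllable_to ::
  "real^'d^'d \<Rightarrow> real^'m^'d \<Rightarrow> (real^'m) set \<Rightarrow> real^'d \<Rightarrow> (real^'d) set" where
  "controllable_to A B U x = {y. \<exists>k\<ge>1. \<exists>u\<in>controls U. solution A B k y u = x}"

definition control_set_props ::
  "real^'d^'d \<Rightarrow> real^'m^'d \<Rightarrow> (real^'m) set \<Rightarrow> (real^'d) set \<Rightarrow> bool" where
  "control_set_props A B U D \<longleftrightarrow>
     (\<forall>x\<in>D. D \<subseteq> closure (reachable A B U x)) \<and>
     (\<forall>x\<in>D. \<exists>u\<in>controls U. \<forall>k\<ge>1. solution A B k x u \<in> D)"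

definition control_set ::
  "real^'d^'d \<Rightarrow> real^'m^'d \<Rightarrow> (real^'m) set \<Rightarrow> (real^'d) set \<Rightarrow> bool" where
  "control_set A B U D \<longleftrightarrow>
     D \<noteq> {} \<and> control_set_props A B U D \<and>
     (\<forall>D'. D \<subseteq> D' \<and> control_set_props A B U D' \<longrightarrow> D' = D)"

definition transitivity_set ::
  "real^'d^'d \<Rightarrow> real^'m^'d \<Rightarrow> (real^'m) set \<Rightarrow> (real^'d) set \<Rightarrow> (real^'d) set" where
  "transitivity_set A B U D = {z \<in> D. z \<in> interior (controllable_to A B U z)}"

(* Controllability of the system without control restriction: U = UNIV. *)
definition controllable :: "real^'d^'d \<Rightarrow> real^'m^'d \<Rightarrow> bool" where
  "controllable A B \<longleftrightarrow> (\<forall>x. reachable A B UNIV x = UNIV)"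

(* The block matrix [B, A B, ..., A^(d-1) B]. Its columns are indexed by pairs (p, j): the block
   number is the position of p in an enumeration of 'd by 0, ..., d-1, and j is the column
   within the block. *)
definition kalman_matrix :: "real^'d^'d \<Rightarrow> real^'m^'d \<Rightarrow> real^('d \<times> 'm)^'d" where
  "kalman_matrix A B =
     (\<chi> i c. (mat_pow A (to_nat_on (UNIV :: 'd set) (fst c)) ** B) $ i $ snd c)"

lemma block_number_bij:
  "bij_betw (to_nat_on (UNIV :: 'd::finite set)) UNIV {..<CARD('d)}"
  by (rule to_nat_on_finite) simp

end

theory Submission
  imports Defs "HOL-Computational_Algebra.Fundamental_Theorem_Algebra"
begin

text \<open>If the system is controllable, the set of points that are reachable from 0 up to closure and
  from which 0 is reachable is a control set containing a neighbourhood of 0. A control set D with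
  an interior point x contains solutions from x that return arbitrarily close to x; scaling them by
  b < 1 frees the controls (1 - b) U, which suffice to move along the whole segment from a x to 0
  for any a < 1. So a x, which lies in D for a near 1, also lies in the control set around 0, and
  control sets that meet coincide. If the system is not controllable, some nonzero complex linear
  functional g satisfies g (A x) = c g x and vanishes on the range of B, and the modulus of g along
  solutions is monotone, which excludes control sets with interior.\<close>

section \<open>Solutions\<close>

lemma solution_cong:
  "(\<And>i. i < k \<Longrightarrow> u i = v i) \<Longrightarrow> solution A B k x u = solution A B k x v"
  by (simp add: solution_def)

lemma solution_add:
  "solution A B k (x + y) (\<lambda>i. u i + v i) = solution A B k x u + solution A B k y v"
  by (induction k) (simp_all add: solution_0 solution_Suc matrix_vector_right_distrib algebra_simps)

lemma solution_scaleR: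
  "solution A B k (c *\<^sub>R x) (\<lambda>i. c *\<^sub>R u i) = c *\<^sub>R solution A B k x u"
  by (induction k)
    (simp_all add: solution_0 solution_Suc matrix_vector_mult_scaleR scaleR_add_right)

lemma solution_zero [simp]: "solution A B k 0 (\<lambda>i. 0) = 0"
  by (simp add: solution_def)

lemma solution_sum:
  "solution A B k 0 (\<lambda>i. \<Sum>j\<in>J. c j *\<^sub>R w j i) = (\<Sum>j\<in>J. c j *\<^sub>R solution A B k 0 (w j))"
proof (induction J rule: infinite_finite_induct)
  case (insert j J)
  then show ?case
    using solution_add[of A B k 0 0 "\<lambda>i. c j *\<^sub>R w j i"] solution_scaleR[of A B k "c j" 0]
    by simp
qed simp_all

lemma solution_superposition:
  "solution A B k x u = solution A B k x (\<lambda>i. 0) + solution A B k 0 u"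
  using solution_add[of A B k x 0 "\<lambda>i. 0" u] by simp

lemma solution_append:
  "solution A B (k + l) x (\<lambda>i. if i < k then u i else v (i - k))
   = solution A B l (solution A B k x u) v"
proof (induction l)
  case 0
  show ?case by (simp add: solution_0) (rule solution_cong, simp)
qed (simp add: solution_Suc)

lemma solution_shift:
  "solution A B (k + l) x u = solution A B l (solution A B k x u) (\<lambda>i. u (k + i))"
  by (induction l) (simp_all add: solution_0 solution_Suc)

lemma continuous_on_solution: "continuous_on S (\<lambda>x. solution A B k x u)"
proof (induction k)
  case (Suc k)
  then have "continuous_on S (\<lambda>x. A *v solution A B k x u)"
    by (rule continuous_on_compose2[OF matrix_vector_mult_linear_continuous_on _ subset_UNIV])
  then show ?case by (simp add: solution_Suc continuous_on_add)
qed (simp add: solution_0)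

lemma controls_append:
  "u \<in> controls U \<Longrightarrow> v \<in> controls U \<Longrightarrow> (\<lambda>i. if i < k then u i else v (i - k)) \<in> controls U"
  by (simp add: controls_def)

section \<open>Reachability\<close>

lemma reachable_iff_controllable_to:
  "y \<in> reachable A B U x \<longleftrightarrow> x \<in> controllable_to A B U y"
  by (auto simp: reachable_def controllable_to_def)

lemma reachableI:
  "solution A B k x u = y \<Longrightarrow> 1 \<le> k \<Longrightarrow> u \<in> controls U \<Longrightarrow> y \<in> reachable A B U x"
  by (auto simp: reachable_def)

lemma reachable_trans:
  assumes "y \<in> reachable A B U x" "z \<in> reachable A B U y"
  shows "z \<in> reachable A B U x"
proof -
  obtain k u where "1 \<le> k" "u \<in> controls U" "y = solution A B k x u"
    using assms(1) by (auto simp: reachable_def)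
  moreover obtain l v where "1 \<le> l" "v \<in> controls U" "z = solution A B l y v"
    using assms(2) by (auto simp: reachable_def)
  ultimately show ?thesis
    using solution_append[of A B k l x u v] by (auto intro!: reachableI controls_append)
qed

text \<open>For a fixed control sequence the time-\<open>k\<close> map is continuous and sends
  \<open>reachable A B U x\<close> into itself, hence also its closure. This makes approximate
  reachability transitive.\<close>

lemma reachable_closure_subset:
  assumes "y \<in> closure (reachable A B U x)"
  shows "closure (reachable A B U y) \<subseteq> closure (reachable A B U x)"
proof (rule closure_minimal)
  show "reachable A B U y \<subseteq> closure (reachable A B U x)"
  proof
    fix z assume "z \<in> reachable A B U y"
    then obtain k u where k: "1 \<le> k" "u \<in> controls U" "z = solution A B k y u"
      by (auto simp: reachable_def)
    have "(\<lambda>x. solution A B k x u) ` closure (reachable A B U x) \<subseteq> closure (reachable A B U x)"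
    proof (rule image_closure_subset[OF continuous_on_solution closed_closure])
      show "(\<lambda>x. solution A B k x u) ` reachable A B U x \<subseteq> closure (reachable A B U x)"
      proof
        fix q assume "q \<in> (\<lambda>x. solution A B k x u) ` reachable A B U x"
        then obtain p where "p \<in> reachable A B U x" "q = solution A B k p u" by blast
        then have "q \<in> reachable A B U x"
          using k by (metis reachable_trans reachableI)
        then show "q \<in> closure (reachable A B U x)" using closure_subset by blast
      qed
    qed
    with assms k show "z \<in> closure (reachable A B U x)" by blast
  qed
qed simp

lemma control_set_propsD:
  assumes "control_set_props A B U D" "x \<in> D"
  shows "D \<subseteq> closure (reachable A B U x)"
    and "\<exists>u\<in>controls U. \<forall>k\<ge>1. solution A B k x u \<in> D"
  using assms(1)[unfolded control_set_props_def, THEN conjunct1, THEN bspec, OF assms(2)]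
    assms(1)[unfolded control_set_props_def, THEN conjunct2, THEN bspec, OF assms(2)] .

text \<open>The union of the two sets again satisfies \<open>control_set_props\<close>: every point
  of it approximately reaches the common point \<open>x\<close>, and \<open>x\<close> approximately
  reaches the whole union. By maximality both sets equal the union.\<close>

lemma control_set_eq_if_meet:
  assumes D: "control_set A B U D" and E: "control_set A B U E" and x: "x \<in> D" "x \<in> E"
  shows "D = E"
proof -
  have pD: "control_set_props A B U D" and pE: "control_set_props A B U E"
    using D E by (auto simp: control_set_def)
  have "D \<union> E \<subseteq> closure (reachable A B U y)" if "y \<in> D \<union> E" for y
  proof -
    have "x \<in> closure (reachable A B U y)"
      using that x control_set_propsD(1)[OF pD] control_set_propsD(1)[OF pE] by blast
    from reachable_closure_subset[OF this] show ?thesis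
      using control_set_propsD(1)[OF pD x(1)] control_set_propsD(1)[OF pE x(2)] by blast
  qed
  moreover have "\<exists>u\<in>controls U. \<forall>k\<ge>1. solution A B k y u \<in> D \<union> E" if "y \<in> D \<union> E" for y
  proof -
    from that consider "y \<in> D" | "y \<in> E" by blast
    then show ?thesis
    proof cases
      case 1
      from control_set_propsD(2)[OF pD this] show ?thesis by (meson UnI1)
    next
      case 2
      from control_set_propsD(2)[OF pE this] show ?thesis by (meson UnI2)
    qed
  qed
  ultimately have props: "control_set_props A B U (D \<union> E)"
    by (simp add: control_set_props_def)
  have "D \<union> E = D"
    using D props by (simp add: control_set_def)
  moreover have "D \<union> E = E"
    using E props by (simp add: control_set_def)
  ultimately show ?thesis by simp
qed

section \<open>The Kalman criterion\<close>

lemma subspace_reach: "subspace (range (solution A B k 0))"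
proof (rule subspaceI)
  show "0 \<in> range (solution A B k 0)"
    by (metis solution_zero rangeI)
next
  fix x y assume "x \<in> range (solution A B k 0)" "y \<in> range (solution A B k 0)"
  then obtain u v where "x = solution A B k 0 u" "y = solution A B k 0 v" by blast
  then have "x + y = solution A B k 0 (\<lambda>i. u i + v i)"
    using solution_add[of A B k 0 0 u v] by simp
  then show "x + y \<in> range (solution A B k 0)" by blast
next
  fix c x assume "x \<in> range (solution A B k 0)"
  then obtain u where "x = solution A B k 0 u" by blast
  then have "c *\<^sub>R x = solution A B k 0 (\<lambda>i. c *\<^sub>R u i)"
    using solution_scaleR[of A B k c 0 u] by simp
  then show "c *\<^sub>R x \<in> range (solution A B k 0)" by blast
qed

text \<open>Expresses the subspace at time \<open>Suc k\<close> through the one at time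
  \<open>k\<close> alone, so that two equal consecutive subspaces force all later ones to be
  equal.\<close>

lemma reach_Suc:
  "range (solution A B (Suc k) 0) = {A *v y + B *v v | y v. y \<in> range (solution A B k 0)}"
proof (intro equalityI subsetI)
  fix x assume "x \<in> {A *v y + B *v v | y v. y \<in> range (solution A B k 0)}"
  then obtain u v where x: "x = A *v solution A B k 0 u + B *v v" by auto
  \<comment> \<open>The control at time \<open>k\<close> has no influence on the solution up to time
    \<open>k\<close>.\<close>
  have "solution A B (Suc k) 0 (u(k := v)) = x"
    using solution_cong[of k "u(k := v)" u A B 0] by (simp add: solution_Suc x)
  then show "x \<in> range (solution A B (Suc k) 0)" by blast
qed (auto simp: solution_Suc)

text \<open>Rest at the origin with control 0 for \<open>l - k\<close> steps, then apply the given
  control.\<close>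

lemma reach_mono:
  assumes "k \<le> l" "0 \<in> U"
  shows "solution A B k 0 ` controls U \<subseteq> solution A B l 0 ` controls U"
proof
  fix y assume "y \<in> solution A B k 0 ` controls U"
  then obtain u where u: "u \<in> controls U" "y = solution A B k 0 u" by auto
  have "(\<lambda>i. if i < l - k then 0 else u (i - (l - k))) \<in> controls U"
    using controls_append[OF _ u(1), of "\<lambda>i. 0" "l - k"] assms(2) by (simp add: controls_def)
  moreover have "solution A B l 0 (\<lambda>i. if i < l - k then 0 else u (i - (l - k))) = y"
    using solution_append[of A B "l - k" k 0 "\<lambda>i. 0" u] assms(1) u(2) by simp
  ultimately show "y \<in> solution A B l 0 ` controls U" by blast
qed

lemma controls_UNIV [simp]: "controls UNIV = UNIV"
  by (simp add: controls_def)

text \<open>The reachable subspaces increase with time and are constant after the first repetition.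
  The dimension can grow strictly at most \<open>CARD('d)\<close> times, so the repetition occurs by
  then; this dimension count takes the place of Cayley-Hamilton.\<close>

lemma reach_stable:
  fixes A :: "real^'d^'d"
  shows "range (solution A B (k + CARD('d)) 0) = range (solution A B CARD('d) 0)"
proof -
  let ?V = "\<lambda>k. range (solution A B k 0)"
  have mono: "?V k \<subseteq> ?V l" if "k \<le> l" for k l
    using reach_mono[OF that, of UNIV A B] by simp
  have stable: "?V (k + n) = ?V n" if "?V (Suc n) = ?V n" for k n
    using that by (induction k) (simp_all add: reach_Suc)
  have "\<exists>n\<le>CARD('d). ?V (Suc n) = ?V n"
  proof (rule ccontr)
    assume neg: "\<not> ?thesis"
    have "n \<le> Suc CARD('d) \<Longrightarrow> n \<le> dim (?V n)" for n
    proof (induction n)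
      case (Suc n)
      then have "?V n \<subset> ?V (Suc n)" using neg mono[of n "Suc n"] by auto
      then have "dim (?V n) < dim (?V (Suc n))"
        by (intro dim_psubset) (metis span_eq_iff subspace_reach)
      with Suc show ?case by linarith
    qed simp
    from this[of "Suc CARD('d)"] show False
      using dim_subset_UNIV_cart[of "?V (Suc CARD('d))"] by linarith
  qed
  then obtain n where n: "n \<le> CARD('d)" "?V (Suc n) = ?V n" by blast
  then show ?thesis
    using stable[OF n(2), of "k + CARD('d) - n"] stable[OF n(2), of "CARD('d) - n"] by simp
qed

lemma reach_invariant:
  fixes A :: "real^'d^'d"
  assumes "y \<in> range (solution A B CARD('d) 0)"
  shows "A *v y + B *v v \<in> range (solution A B CARD('d) 0)"
proof -
  have "A *v y + B *v v \<in> range (solution A B (Suc CARD('d)) 0)"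
    using assms unfolding reach_Suc by blast
  then show ?thesis using reach_stable[of A B 1] by (simp only: plus_1_eq_Suc)
qed

text \<open>In the solution at time d the power \<open>A^i\<close> multiplies the control of time
  \<open>d - 1 - i\<close>. Thus the blocks of a coefficient vector are the controls in reversed
  order of time.\<close>

lemma range_kalman_matrix:
  fixes A :: "real^'d^'d" and B :: "real^'m^'d"
  shows "range ((*v) (kalman_matrix A B)) = range (solution A B CARD('d) 0)"
proof -
  let ?n = "to_nat_on (UNIV :: 'd set)"
  let ?d = "CARD('d)"
  have mult: "kalman_matrix A B *v c = (\<Sum>p\<in>UNIV. mat_pow A (?n p) *v (B *v (\<chi> j. c $ (p, j))))"
    for c
  proof -
    have "(kalman_matrix A B *v c) $ i
      = (\<Sum>p\<in>UNIV. mat_pow A (?n p) *v (B *v (\<chi> j. c $ (p, j)))) $ i" for i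
    proof -
      have "(kalman_matrix A B *v c) $ i
        = (\<Sum>p\<in>UNIV. \<Sum>j\<in>UNIV. kalman_matrix A B $ i $ (p, j) * c $ (p, j))"
        unfolding matrix_vector_mult_def sum.cartesian_product UNIV_Times_UNIV by simp
      also have "\<dots> = (\<Sum>p\<in>UNIV. ((mat_pow A (?n p) ** B) *v (\<chi> j. c $ (p, j))) $ i)"
        by (simp add: kalman_matrix_def matrix_vector_mult_def)
      finally show ?thesis by (simp only: sum_component matrix_vector_mul_assoc)
    qed
    then show ?thesis by (simp add: vec_eq_iff)
  qed
  have sol: "solution A B ?d 0 u = (\<Sum>p\<in>UNIV. mat_pow A (?n p) *v (B *v u (?d - 1 - ?n p)))" for u
  proof -
    have "solution A B ?d 0 u = (\<Sum>i<?d. mat_pow A i *v (B *v u (?d - 1 - i)))"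
      unfolding solution_def
      by (subst sum.nat_diff_reindex[symmetric]) (auto intro: sum.cong)
    also have "\<dots> = (\<Sum>p\<in>UNIV. mat_pow A (?n p) *v (B *v u (?d - 1 - ?n p)))"
      using sum.reindex_bij_betw[OF block_number_bij] by (rule sym)
    finally show ?thesis .
  qed
  show ?thesis
  proof (intro equalityI image_subsetI)
    fix c :: "real^('d \<times> 'm)"
    define u where "u i = (\<chi> j. c $ (inv_into UNIV ?n (?d - 1 - i), j))" for i
    have "u (?d - 1 - ?n p) = (\<chi> j. c $ (p, j))" for p
    proof -
      have "?n p < ?d" "inj ?n"
        using block_number_bij[where 'd = 'd] by (auto simp: bij_betw_def)
      then show ?thesis by (simp add: u_def)
    qed
    then have "kalman_matrix A B *v c = solution A B ?d 0 u" by (simp add: mult sol)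
    then show "kalman_matrix A B *v c \<in> range (solution A B ?d 0)" by simp
  next
    fix u :: "nat \<Rightarrow> real^'m"
    have "solution A B ?d 0 u = kalman_matrix A B *v (\<chi> q. u (?d - 1 - ?n (fst q)) $ snd q)"
      by (simp add: mult sol)
    then show "solution A B ?d 0 u \<in> range ((*v) (kalman_matrix A B))" by simp
  qed
qed

lemma rank_kalman_iff:
  fixes A :: "real^'d^'d" and B :: "real^'m^'d"
  shows "rank (kalman_matrix A B) = CARD('d) \<longleftrightarrow> range (solution A B CARD('d) 0) = UNIV"
  by (simp add: full_rank_surjective range_kalman_matrix)

text \<open>Subtracting the free motion reduces an arbitrary initial point to 0, and stabilization
  of the reachable subspaces reduces an arbitrary time to \<open>CARD('d)\<close>.\<close>

lemma controllable_iff_reach: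
  fixes A :: "real^'d^'d" and B :: "real^'m^'d"
  shows "controllable A B \<longleftrightarrow> range (solution A B CARD('d) 0) = UNIV"
proof
  assume "controllable A B"
  show "range (solution A B CARD('d) 0) = UNIV"
  proof (intro equalityI subsetI)
    fix y
    have "y \<in> reachable A B UNIV 0"
      using \<open>controllable A B\<close> by (simp add: controllable_def)
    then obtain k where "y \<in> range (solution A B k 0)" by (auto simp: reachable_def)
    then have "y \<in> range (solution A B (k + CARD('d)) 0)"
      using reach_mono[of k "k + CARD('d)" UNIV A B] by auto
    then show "y \<in> range (solution A B CARD('d) 0)" by (simp add: reach_stable)
  qed simp
next
  assume full: "range (solution A B CARD('d) 0) = UNIV"
  have "y \<in> reachable A B UNIV x" for x y
  proof -
    obtain u where "y - solution A B CARD('d) x (\<lambda>i. 0) = solution A B CARD('d) 0 u"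
      using full by blast
    then have "solution A B CARD('d) x u = y"
      by (subst solution_superposition) (simp add: algebra_simps)
    then show ?thesis by (auto intro: reachableI simp: Suc_le_eq)
  qed
  then show "controllable A B" by (auto simp: controllable_def)
qed

section \<open>Eigenfunctionals of uncontrollable systems\<close>

text \<open>A linear relation among the first \<open>DIM('a) + 1\<close> vectors, recorded as a
  polynomial. Applied to the row vectors \<open>w v* mat_pow A i\<close>, it yields a polynomial in
  \<open>A\<close> that is annihilated by \<open>w\<close> from the left.\<close>

lemma sequence_dependent:
  fixes v :: "nat \<Rightarrow> 'a::euclidean_space"
  obtains p :: "real poly" where "p \<noteq> 0" "(\<Sum>i\<le>degree p. coeff p i *\<^sub>R v i) = 0"
proof -
  \<comment> \<open>Padding with zero coefficients: a bound on the degree suffices below.\<close>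
  have eq: "(\<Sum>i\<le>degree p. coeff p i *\<^sub>R v i) = (\<Sum>i\<le>N. coeff p i *\<^sub>R v i)"
    if "degree p \<le> N" for p :: "real poly" and N
    using that by (intro sum.mono_neutral_left) (auto simp: coeff_eq_0)
  show thesis
  proof (cases "inj_on v {..DIM('a)}")
    case True
    have "dependent (v ` {..DIM('a)})"
      by (rule dependent_biggerset) (simp add: card_image[OF True])
    then obtain u y where u: "y \<in> v ` {..DIM('a)}" "u y \<noteq> 0"
      "(\<Sum>x\<in>v ` {..DIM('a)}. u x *\<^sub>R x) = 0"
      by (auto simp: dependent_finite)
    define p where "p = (\<Sum>i\<le>DIM('a). monom (u (v i)) i)"
    have c: "coeff p i = (if i \<le> DIM('a) then u (v i) else 0)" for i
      by (simp add: p_def coeff_sum)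
    have "degree p \<le> DIM('a)" by (rule degree_le) (simp add: c)
    moreover have "(\<Sum>i\<le>DIM('a). coeff p i *\<^sub>R v i) = 0"
      using u(3) by (simp add: c sum.reindex[OF True])
    moreover have "p \<noteq> 0" using u(1,2) c by (metis atMost_iff coeff_0 imageE)
    ultimately show thesis using that[of p] eq by simp
  next
    \<comment> \<open>A repeated vector shrinks the image, so the dimension count fails; the
      repetition itself gives the relation.\<close>
    case False
    then obtain i j where ij: "i \<noteq> j" "v i = v j" by (auto simp: inj_on_def)
    define p where "p = monom (1::real) i - monom 1 j"
    have c: "coeff p k = (if k = i then 1 else 0) - (if k = j then 1 else 0)" for k
      by (auto simp: p_def)
    have "degree p \<le> i + j" by (rule degree_le) (simp add: c)
    moreover have "(\<Sum>k\<le>i + j. coeff p k *\<^sub>R v k) = 0"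
      using ij(2) by (simp add: c scaleR_left_diff_distrib sum_subtractf
          if_distrib[of "\<lambda>c. c *\<^sub>R _"] cong: if_cong)
    moreover have "p \<noteq> 0" using ij(1) c[of i] by auto
    ultimately show thesis using that[of p] eq by simp
  qed
qed

text \<open>One direction of the Hautus test. Let \<open>w\<close> be orthogonal to the reachable
  subspace and let \<open>p\<close> be a nonzero complex polynomial of least degree with
  \<open>w^T p(A) = 0\<close>. Splitting off a root, \<open>p = (X - c) r\<close>, the functional
  \<open>w^T r(A)\<close> is nonzero by minimality, is an eigenfunctional for \<open>c\<close>, and
  vanishes on the range of \<open>B\<close>.\<close>

lemma uncontrollable_eigenfunctional:
  fixes A :: "real^'d^'d" and B :: "real^'m^'d"
  assumes "\<not> controllable A B"
  obtains g :: "real^'d \<Rightarrow> complex" and c where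
    "linear g" "g \<noteq> (\<lambda>x. 0)" "\<And>x. g (A *v x) = c * g x" "\<And>v. g (B *v v) = 0"
proof -
  let ?V = "range (solution A B CARD('d) 0)"
  have V: "subspace ?V" "?V \<noteq> UNIV"
    using assms by (simp_all add: subspace_reach controllable_iff_reach)
  then have "span ?V \<subset> span UNIV" by (simp add: span_eq_iff[THEN iffD2] psubset_eq)
  then obtain w where w: "w \<noteq> 0" "\<And>y. y \<in> ?V \<Longrightarrow> orthogonal w y"
    using orthogonal_to_subspace_exists_gen by (metis span_base)
  \<comment> \<open>\<open>act p\<close> is the functional \<open>w^T p(A)\<close>. It is
    complex-valued because the root of \<open>p\<close> chosen later need not be real.\<close>
  define h where "h i x = complex_of_real (inner w (mat_pow A i *v x))" for i x
  define act where "act p x = (\<Sum>i\<le>degree p. coeff p i * h i x)" for p x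
  have h_Suc: "h i (A *v x) = h (Suc i) x" for i x
  proof -
    have "mat_pow A i ** A = A ** mat_pow A i"
      by (induction i) (simp_all add: matrix_mul_assoc[symmetric])
    then show ?thesis by (simp add: h_def matrix_vector_mul_assoc)
  qed
  have h_lin: "linear (h i)" for i
    by (auto intro!: linearI simp: h_def matrix_vector_right_distrib matrix_vector_mult_scaleR
        inner_add_right scaleR_conv_of_real[where 'a = complex])
  have h_B: "h i (B *v v) = 0" for i v
  proof -
    \<comment> \<open>The reachable subspace contains the range of \<open>B\<close> and is invariant
      under \<open>A\<close>.\<close>
    have "mat_pow A i *v (B *v v) \<in> ?V"
    proof (induction i)
      case 0
      show ?case using reach_invariant[of 0 A B v] V(1) subspace_0 by auto
    next
      case (Suc i)
      then show ?case
        using reach_invariant[OF Suc, of 0]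
        by (simp add: matrix_vector_mul_assoc matrix_mul_assoc)
    qed
    then show ?thesis using w(2) by (simp add: h_def orthogonal_def)
  qed
  have act_lin: "linear (act p)" for p
    by (rule linearI)
      (simp_all add: act_def linear_add[OF h_lin] linear_scale[OF h_lin] distrib_left
        sum.distrib scaleR_sum_right)
  obtain q :: "real poly" where q: "q \<noteq> 0"
    "(\<Sum>i\<le>degree q. coeff q i *\<^sub>R (w v* mat_pow A i)) = 0"
    by (rule sequence_dependent)
  have "act (map_poly of_real q) x = 0" for x
  proof -
    have "act (map_poly of_real q) x
        = complex_of_real (inner (\<Sum>i\<le>degree q. coeff q i *\<^sub>R (w v* mat_pow A i)) x)"
      by (simp add: act_def h_def coeff_map_poly degree_map_poly inner_sum_left dot_lmul_matrix)
    then show ?thesis by (simp add: q(2))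
  qed
  moreover have "map_poly complex_of_real q \<noteq> 0"
    using q(1) by (simp add: map_poly_eq_0_iff)
  ultimately have "map_poly complex_of_real q \<noteq> 0 \<and> act (map_poly of_real q) = (\<lambda>x. 0)"
    by blast
  then obtain p where p: "p \<noteq> 0" "act p = (\<lambda>x. 0)"
    and least: "\<And>r. r \<noteq> 0 \<Longrightarrow> degree r < degree p \<Longrightarrow> act r \<noteq> (\<lambda>x. 0)"
    using ex_has_least_nat[of "\<lambda>p. p \<noteq> 0 \<and> act p = (\<lambda>x. 0)" _ degree] by (metis not_less)
  \<comment> \<open>A nonzero constant \<open>p\<close> would give \<open>act p w\<close> a nonzero
    multiple of the squared norm of \<open>w\<close>.\<close>
  have "degree p \<noteq> 0"
  proof
    assume "degree p = 0"
    then have "act p w = lead_coeff p * of_real (inner w w)"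
      by (simp add: act_def h_def)
    with p w(1) show False by simp
  qed
  then obtain c where "poly p c = 0"
    using fundamental_theorem_of_algebra[of p] by (auto simp: constant_degree)
  then obtain r where r: "p = [:-c, 1:] * r" by (auto simp: poly_eq_0_iff_dvd)
  have r0: "r \<noteq> 0" using p(1) r by auto
  have deg: "degree p = Suc (degree r)"
    unfolding r using r0 by (subst degree_mult_eq) simp_all
  show thesis
  proof (rule that)
    show "linear (act r)" by (rule act_lin)
    show "act r \<noteq> (\<lambda>x. 0)" using least[OF r0] deg by simp
    show "act r (B *v v) = 0" for v by (simp add: act_def h_B)
    show "act r (A *v x) = c * act r x" for x
    proof -
      \<comment> \<open>The coefficients of \<open>(X - c) r\<close> are those of \<open>r\<close>
        shifted by one, minus \<open>c\<close> times those of \<open>r\<close>. The shift turns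
        \<open>h i\<close> into \<open>h (Suc i)\<close>, which is \<open>h i\<close> after
        \<open>A\<close>.\<close>
      have "0 = act p x" by (simp add: p(2))
      also have "\<dots> = (\<Sum>i\<le>Suc (degree r).
          ((case i of 0 \<Rightarrow> 0 | Suc j \<Rightarrow> coeff r j) - c * coeff r i) * h i x)"
        unfolding act_def deg by (simp add: r coeff_pCons split: nat.split cong: sum.cong)
      also have "\<dots> = (\<Sum>i\<le>Suc (degree r). (case i of 0 \<Rightarrow> 0 | Suc j \<Rightarrow> coeff r j) * h i x)
          - (\<Sum>i\<le>Suc (degree r). c * coeff r i * h i x)"
        by (simp only: left_diff_distrib sum_subtractf)
      also have "\<dots> = act r (A *v x) - c * act r x"
        by (subst sum.atMost_Suc_shift)
          (simp add: act_def h_Suc sum_distrib_left mult.assoc coeff_eq_0)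
      finally show ?thesis by simp
    qed
  qed
qed

lemma eigenfunctional_solution:
  fixes g :: "real^'d \<Rightarrow> complex"
  assumes "linear g" "\<And>x. g (A *v x) = c * g x" "\<And>v. g (B *v v) = 0"
  shows "g (solution A B k x u) = c ^ k * g x"
  by (induction k) (simp_all add: solution_0 solution_Suc linear_add[OF assms(1)] assms(2,3))

text \<open>The modulus of \<open>g\<close> is multiplied by \<open>norm c\<close> in each step. It
  therefore stays on one side of its initial value, also on the closure of the reachable set,
  whereas a neighbourhood of a point with \<open>g x \<noteq> 0\<close> contains multiples of
  \<open>x\<close> on both sides.\<close>

lemma controllable_if_control_set:
  fixes A :: "real^'d^'d" and B :: "real^'m^'d"
  assumes D: "control_set A B U D" and int: "interior D \<noteq> {}"
  shows "controllable A B"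
proof (rule ccontr)
  assume "\<not> controllable A B"
  then obtain g :: "real^'d \<Rightarrow> complex" and c where
    g: "linear g" "g \<noteq> (\<lambda>x. 0)" "\<And>x. g (A *v x) = c * g x" "\<And>v. g (B *v v) = 0"
    using uncontrollable_eigenfunctional by blast
  \<comment> \<open>The kernel of \<open>g\<close> is a proper subspace and has empty
    interior.\<close>
  have "\<not> interior D \<subseteq> {x. g x = 0}"
  proof
    assume sub: "interior D \<subseteq> {x. g x = 0}"
    have "subspace {x. g x = 0}" using linear_subspace_kernel[OF g(1)] .
    then have span: "span {x. g x = 0} = {x. g x = 0}" by (simp only: span_eq_iff)
    have "interior {x. g x = 0} \<noteq> {}"
      using int interior_maximal[OF sub open_interior] by blast
    then have "dim {x. g x = 0} = DIM(real^'d)"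
      using empty_interior_lowdim[of "{x. g x = 0}"] dim_subset_UNIV[of "{x. g x = 0}"]
      by linarith
    then have "{x. g x = 0} = UNIV" using span by (simp only: dim_eq_full)
    with g(2) show False by (auto simp: fun_eq_iff)
  qed
  then obtain x where x: "x \<in> interior D" "g x \<noteq> 0" by blast
  then obtain e where e: "e > 0" "ball x e \<subseteq> D"
    by (auto simp: mem_interior)
  \<comment> \<open>The second bound keeps both multiples \<open>1 + \<delta>\<close> and
    \<open>1 - \<delta>\<close> of \<open>x\<close> in the ball; the bound 1 keeps
    \<open>1 - \<delta>\<close> nonnegative, so that its absolute value is below 1.\<close>
  define \<delta> where "\<delta> = min 1 (e / (2 * (norm x + 1)))"
  have nx: "norm x + 1 > 0" by (simp add: add_nonneg_pos)
  then have \<delta>: "\<delta> > 0" using e by (simp add: \<delta>_def)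
  have near: "(1 + t) *\<^sub>R x \<in> D" if "\<bar>t\<bar> = \<delta>" for t
  proof -
    have "\<bar>t\<bar> * norm x \<le> \<delta> * (norm x + 1)" using \<delta> that by (intro mult_mono) auto
    also have "\<dots> \<le> e / (2 * (norm x + 1)) * (norm x + 1)"
      using nx by (intro mult_right_mono) (auto simp: \<delta>_def)
    also have "\<dots> = e / 2" using nx by (simp add: divide_simps)
    also have "\<dots> < e" using e by simp
    finally have "(1 + t) *\<^sub>R x \<in> ball x e" by (simp add: dist_norm algebra_simps)
    then show ?thesis using e by blast
  qed
  have mem: "(1 + t) *\<^sub>R x \<in> closure (reachable A B U x)" if "\<bar>t\<bar> = \<delta>" for t
    using near[OF that] D x interior_subset
    unfolding control_set_def control_set_props_def by blast
  have cont: "continuous_on S (\<lambda>y. norm (g y))" for S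
    using g(1) by (intro continuous_intros linear_continuous_on) (simp add: linear_conv_bounded_linear)
  have norm_g: "norm (g ((1 + t) *\<^sub>R x)) = \<bar>1 + t\<bar> * norm (g x)" for t
    by (simp add: linear_scale[OF g(1)])
  have reach: "\<exists>k. norm (g y) = norm c ^ k * norm (g x)" if "y \<in> reachable A B U x" for y
    using that eigenfunctional_solution[OF g(1,3,4)]
    by (auto simp: reachable_def norm_mult norm_power)
  have gx: "norm (g x) > 0" using x by simp
  show False
  proof (cases "norm c \<le> 1")
    case True
    have "norm (g y) \<le> norm (g x)" if "y \<in> closure (reachable A B U x)" for y
    proof -
      have "norm (g z) \<le> norm (g x)" if "z \<in> reachable A B U x" for z
        using reach[OF that] power_le_one[OF norm_ge_zero True] gx by (auto simp: mult_le_cancel_right1)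
      then have "reachable A B U x \<subseteq> {y. norm (g y) \<le> norm (g x)}" by blast
      moreover have "closed {y. norm (g y) \<le> norm (g x)}"
        by (intro closed_Collect_le cont continuous_on_const)
      ultimately show ?thesis using closure_minimal that by blast
    qed
    from this[OF mem, of \<delta>] show False using \<delta> gx by (simp add: norm_g)
  next
    case False
    have "norm (g x) \<le> norm (g y)" if "y \<in> closure (reachable A B U x)" for y
    proof -
      have "norm (g x) \<le> norm (g z)" if "z \<in> reachable A B U x" for z
        using reach[OF that] one_le_power[of "norm c"] False gx by (auto simp: mult_le_cancel_right1)
      then have "reachable A B U x \<subseteq> {y. norm (g x) \<le> norm (g y)}" by blast
      moreover have "closed {y. norm (g x) \<le> norm (g y)}"
        by (intro closed_Collect_le cont continuous_on_const)
      ultimately show ?thesis using closure_minimal that by blast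
    qed
    from this[OF mem, of "- \<delta>"] have "1 \<le> \<bar>1 - \<delta>\<bar>"
      using \<delta> gx norm_g[of "- \<delta>"] by simp
    moreover have "\<delta> \<le> 1" by (simp add: \<delta>_def)
    ultimately show False using \<delta> by simp
  qed
qed

section \<open>The control set around the origin\<close>

text \<open>Unbounded controls \<open>w j\<close> steer 0 to the unit vectors. Combining them with
  the coordinates of a small target gives controls so small that they lie in a ball around 0 inside
  \<open>U\<close>.\<close>

lemma ball_subset_reach:
  fixes A :: "real^'d^'d" and B :: "real^'m^'d"
  assumes full: "range (solution A B K 0) = UNIV" and U: "0 \<in> interior U"
  obtains r where "r > 0" "ball 0 r \<subseteq> solution A B K 0 ` controls U"
proof -
  have "\<forall>j. \<exists>u. solution A B K 0 u = axis j 1" using full by (metis rangeE UNIV_I)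
  then obtain w where w: "\<And>j. solution A B K 0 (w j) = axis j 1" by metis
  obtain e where e: "e > 0" "ball 0 e \<subseteq> U"
    using U by (auto simp: mem_interior)
  \<comment> \<open>At each time before \<open>K\<close>, the control built for \<open>y\<close> has
    norm at most \<open>norm y * M\<close>; the summand 1 makes \<open>M\<close> positive.\<close>
  define M where "M = 1 + (\<Sum>i<K. \<Sum>j\<in>UNIV. norm (w j i))"
  have M: "M > 0" by (simp add: M_def add_pos_nonneg sum_nonneg)
  show thesis
  proof (rule that[of "e / M"])
    show "e / M > 0" using e M by simp
    show "ball 0 (e / M) \<subseteq> solution A B K 0 ` controls U"
    proof
      fix y :: "real^'d" assume "y \<in> ball 0 (e / M)"
      then have y: "norm y * M < e" using M by (simp add: field_simps)
      define u where "u i = (if i < K then \<Sum>j\<in>UNIV. y $ j *\<^sub>R w j i else 0)" for i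
      have "solution A B K 0 u = solution A B K 0 (\<lambda>i. \<Sum>j\<in>UNIV. y $ j *\<^sub>R w j i)"
        by (rule solution_cong) (simp add: u_def)
      also have "\<dots> = (\<Sum>j\<in>UNIV. y $ j *\<^sub>R axis j 1)" by (simp add: solution_sum w)
      also have "\<dots> = y"
        using basis_expansion[of y] by (simp add: scalar_mult_eq_scaleR)
      finally have "solution A B K 0 u = y" .
      moreover have "u i \<in> U" for i
      proof (cases "i < K")
        case True
        have "norm (u i) \<le> (\<Sum>j\<in>UNIV. norm y * norm (w j i))"
          using True component_le_norm_cart[of y]
          by (auto simp: u_def intro!: sum_norm_le mult_right_mono)
        also have "\<dots> = norm y * (\<Sum>j\<in>UNIV. norm (w j i))" by (simp add: sum_distrib_left)
        also have "\<dots> \<le> norm y * M"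
        proof (rule mult_left_mono)
          have "(\<Sum>j\<in>UNIV. norm (w j i)) \<le> (\<Sum>i<K. \<Sum>j\<in>UNIV. norm (w j i))"
            using True by (intro member_le_sum) (auto intro: sum_nonneg)
          then show "(\<Sum>j\<in>UNIV. norm (w j i)) \<le> M" by (simp add: M_def)
        qed simp
        finally show ?thesis using y e by auto
      next
        case False
        then show ?thesis using e by (auto simp: u_def)
      qed
      ultimately show "y \<in> solution A B K 0 ` controls U" by (auto simp: controls_def)
    qed
  qed
qed

text \<open>The two conditions are deliberately asymmetric: the closure admits points that are only
  approximately reachable, as maximality demands, while exact steering to 0 provides a control under
  which the solution stays in the set.\<close>

definition origin_control_set ::
  "real^'d^'d \<Rightarrow> real^'m^'d \<Rightarrow> (real^'m) set \<Rightarrow> (real^'d) set" where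
  "origin_control_set A B U = closure (reachable A B U 0) \<inter> controllable_to A B U 0"

lemma zero_reachable_zero: "0 \<in> U \<Longrightarrow> 0 \<in> reachable A B U 0"
  by (rule reachableI[of _ _ 1 _ "\<lambda>i. 0"]) (simp_all add: controls_def)

text \<open>If the free motion from \<open>y\<close> ends within \<open>ball 0 r\<close> at time
  \<open>K\<close>, a control cancels it, since the ball is symmetric. This gives a neighbourhood
  \<open>W\<close> of 0; for any other point, pull \<open>W\<close> back along the solution that
  steers it to 0.\<close>

lemma open_controllable_to_zero:
  assumes r: "r > 0" "ball 0 r \<subseteq> solution A B K 0 ` controls U" and K: "1 \<le> K"
  shows "open (controllable_to A B U 0)"
proof -
  define W where "W = (\<lambda>y. solution A B K y (\<lambda>i. 0)) -` ball 0 r"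
  have W: "open W" "0 \<in> W" "W \<subseteq> controllable_to A B U 0"
  proof -
    show "open W"
      unfolding W_def by (rule open_vimage[OF open_ball continuous_on_solution])
    show "0 \<in> W" using r by (simp add: W_def)
    show "W \<subseteq> controllable_to A B U 0"
    proof
      fix y assume "y \<in> W"
      then have "- solution A B K y (\<lambda>i. 0) \<in> ball 0 r" by (simp add: W_def)
      then obtain u where u: "u \<in> controls U" "solution A B K 0 u = - solution A B K y (\<lambda>i. 0)"
        using subsetD[OF r(2)] by (metis imageE)
      then have "solution A B K y u = 0" by (subst solution_superposition) simp
      with u(1) K show "y \<in> controllable_to A B U 0" by (auto simp: controllable_to_def)
    qed
  qed
  show ?thesis
  proof (subst open_subopen, intro ballI)
    fix y assume "y \<in> controllable_to A B U 0"
    then obtain k u where u: "1 \<le> k" "u \<in> controls U" "solution A B k y u = 0"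
      by (auto simp: controllable_to_def)
    let ?T = "(\<lambda>x. solution A B k x u) -` W"
    have "open ?T" using W(1) continuous_on_solution by (rule open_vimage)
    moreover have "y \<in> ?T" using u W by simp
    moreover have "?T \<subseteq> controllable_to A B U 0"
    proof
      fix z assume "z \<in> ?T"
      then have "0 \<in> reachable A B U (solution A B k z u)"
        using W(3) by (auto simp: reachable_iff_controllable_to)
      moreover have "solution A B k z u \<in> reachable A B U z"
        using u by (intro reachableI) auto
      ultimately show "z \<in> controllable_to A B U 0"
        using reachable_trans by (metis reachable_iff_controllable_to)
    qed
    ultimately show "\<exists>T. open T \<and> y \<in> T \<and> T \<subseteq> controllable_to A B U 0" by blast
  qed
qed

text \<open>Any point of the set approximately reaches any other by way of 0. Along a control that
  leads to 0 and is 0 afterwards, the solution can still be steered to 0 at all times.\<close>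

lemma origin_control_set_props:
  assumes "0 \<in> U"
  shows "control_set_props A B U (origin_control_set A B U)"
  unfolding control_set_props_def
proof (intro conjI ballI)
  fix x assume "x \<in> origin_control_set A B U"
  then have x: "x \<in> closure (reachable A B U 0)" "0 \<in> reachable A B U x"
    by (simp_all add: origin_control_set_def reachable_iff_controllable_to)
  from x(2) have "closure (reachable A B U 0) \<subseteq> closure (reachable A B U x)"
    using reachable_closure_subset closure_subset by blast
  then show "origin_control_set A B U \<subseteq> closure (reachable A B U x)"
    by (auto simp: origin_control_set_def)
  obtain k u where u: "1 \<le> k" "u \<in> controls U" "solution A B k x u = 0"
    using x(2) by (auto simp: reachable_def)
  \<comment> \<open>After the arrival at 0 the zero control holds the solution there.\<close>
  define v where "v i = (if i < k then u i else 0)" for i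
  have v: "v \<in> controls U" using u(2) assms by (auto simp: v_def controls_def)
  have vk: "solution A B k x v = 0"
    using solution_cong[of k v u A B x] u(3) by (simp add: v_def)
  have "solution A B n x v \<in> origin_control_set A B U" if n: "1 \<le> n" for n
  proof -
    have "solution A B n x v \<in> closure (reachable A B U 0)"
      using reachable_closure_subset[OF x(1)] reachableI[OF refl n v] closure_subset by blast
    moreover have "0 \<in> reachable A B U (solution A B n x v)"
    proof (cases "n < k")
      case True
      then have "solution A B (k - n) (solution A B n x v) (\<lambda>i. v (n + i)) = 0"
        using solution_shift[of A B n "k - n" x v] vk by simp
      then show ?thesis
        using True v by (intro reachableI[of _ _ "k - n" _ "\<lambda>i. v (n + i)"])
          (simp_all add: controls_def)
    next
      case False
      then have "solution A B n x v = solution A B (n - k) 0 (\<lambda>i. v (k + i))"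
        using solution_shift[of A B k "n - k" x v] vk by simp
      then have "solution A B n x v = 0" by (simp add: v_def)
      then show ?thesis using zero_reachable_zero[OF assms] by simp
    qed
    ultimately show ?thesis
      by (simp add: origin_control_set_def reachable_iff_controllable_to)
  qed
  with v show "\<exists>u\<in>controls U. \<forall>k\<ge>1. solution A B k x u \<in> origin_control_set A B U" by blast
qed

lemma origin_control_set_interior:
  assumes r: "r > 0" "ball 0 r \<subseteq> solution A B K 0 ` controls U" and K: "1 \<le> K"
  shows "0 \<in> interior (origin_control_set A B U)"
    "0 \<in> interior (controllable_to A B U 0)"
proof -
  have "solution A B K 0 ` controls U \<subseteq> reachable A B U 0"
    using K by (auto intro: reachableI)
  with r(2) have sub: "ball 0 r \<subseteq> reachable A B U 0" by (rule subset_trans)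
  have op: "open (controllable_to A B U 0)" using open_controllable_to_zero[OF r K] .
  have z: "0 \<in> controllable_to A B U 0"
    using sub r(1) by (simp add: reachable_iff_controllable_to[symmetric] subset_iff)
  show "0 \<in> interior (controllable_to A B U 0)" using op z by (simp add: interior_open)
  show "0 \<in> interior (origin_control_set A B U)"
  proof (rule interiorI)
    show "open (ball 0 r \<inter> controllable_to A B U 0)" using op by blast
    show "0 \<in> ball 0 r \<inter> controllable_to A B U 0" using r z by simp
    show "ball 0 r \<inter> controllable_to A B U 0 \<subseteq> origin_control_set A B U"
      using sub closure_subset by (auto simp: origin_control_set_def)
  qed
qed

text \<open>For maximality: a point of a larger set approximately reaches 0, hence enters the open
  set \<open>controllable_to A B U 0\<close>, from which 0 is reached exactly.\<close>

lemma control_set_origin: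
  assumes r: "r > 0" "ball 0 r \<subseteq> solution A B K 0 ` controls U" and K: "1 \<le> K"
    and U: "0 \<in> U"
  shows "control_set A B U (origin_control_set A B U)"
  unfolding control_set_def
proof (intro conjI allI impI)
  have 0: "0 \<in> origin_control_set A B U"
    using origin_control_set_interior[OF r K] interior_subset by blast
  then show "origin_control_set A B U \<noteq> {}" by blast
  show "control_set_props A B U (origin_control_set A B U)"
    using origin_control_set_props[OF U] .
  fix D assume D: "origin_control_set A B U \<subseteq> D \<and> control_set_props A B U D"
  have "x \<in> origin_control_set A B U" if "x \<in> D" for x
  proof -
    have "x \<in> closure (reachable A B U 0)" "0 \<in> closure (reachable A B U x)"
      using D that 0 unfolding control_set_props_def by blast+
    moreover have "0 \<in> controllable_to A B U 0" using 0 by (simp add: origin_control_set_def)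
    ultimately obtain y where "y \<in> reachable A B U x" "y \<in> controllable_to A B U 0"
      using open_controllable_to_zero[OF r K]
      by (meson closure_iff_nhds_not_empty disjoint_iff subset_refl)
    then have "0 \<in> reachable A B U x"
      by (metis reachable_iff_controllable_to reachable_trans)
    with \<open>x \<in> closure _\<close> show ?thesis
      by (simp add: origin_control_set_def reachable_iff_controllable_to)
  qed
  with D show "D = origin_control_set A B U" by blast
qed

section \<open>Uniqueness\<close>

text \<open>Move \<open>K\<close> steps within \<open>D\<close>, then use that \<open>x\<close> is
  approximately reachable from the point of arrival. The detour makes the return time at least
  \<open>K\<close>, long enough for controls in \<open>U\<close> to reach a whole ball from
  0.\<close>

lemma near_return:
  assumes D: "control_set_props A B U D" and x: "x \<in> D" and "\<epsilon> > 0" "1 \<le> K"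
  obtains k u where "K \<le> k" "u \<in> controls U" "norm (solution A B k x u - x) < \<epsilon>"
proof -
  obtain v where v: "v \<in> controls U" "solution A B K x v \<in> D"
    using D x \<open>1 \<le> K\<close> unfolding control_set_props_def by blast
  then have "x \<in> closure (reachable A B U (solution A B K x v))"
    using D x unfolding control_set_props_def by blast
  then obtain y where "y \<in> reachable A B U (solution A B K x v)" "dist y x < \<epsilon>"
    using \<open>\<epsilon> > 0\<close> closure_approachable by blast
  then obtain l u where u: "u \<in> controls U" "norm (solution A B l (solution A B K x v) u - x) < \<epsilon>"
    by (auto simp: reachable_def dist_norm)
  show thesis
    by (rule that[of "K + l" "\<lambda>i. if i < K then v i else u (i - K)"])
      (use u v in \<open>auto simp: solution_append intro!: controls_append\<close>)
qed

text \<open>By convexity the controls \<open>b *\<^sub>R u i + (1 - b) *\<^sub>R v i\<close> are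
  admissible. The first part leads from \<open>b *\<^sub>R x\<close> back to itself up to the scaled
  defect; the second adds any vector of norm below \<open>(1 - b) * r\<close>, which corrects the
  defect and moves on to \<open>y\<close>. The factor 1/2 divides this reserve between the two
  tasks.\<close>

lemma reach_along_segment:
  assumes r: "ball 0 r \<subseteq> solution A B K 0 ` controls U" and K: "1 \<le> K" "K \<le> k"
    and U: "convex U" "0 \<in> U" and u: "u \<in> controls U"
    and a: "a < 1" and b: "0 \<le> b" "b \<le> a"
    and defect: "norm (solution A B k x u - x) < (1 - a) * r / 2"
    and y: "norm (y - b *\<^sub>R x) < (1 - a) * r / 2"
  shows "y \<in> reachable A B U (b *\<^sub>R x)"
proof -
  define e where "e = solution A B k x u - x"
  \<comment> \<open>The required correction, rescaled to the target that \<open>v\<close> has to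
    reach from 0.\<close>
  define z where "z = (1 / (1 - b)) *\<^sub>R (y - b *\<^sub>R x - b *\<^sub>R e)"
  have b1: "1 - b > 0" using a b by simp
  then have "0 < (1 - a) * r" using defect by (smt (verit) norm_ge_zero half_gt_zero_iff)
  then have r0: "r > 0" using a by (simp add: zero_less_mult_iff)
  have "norm (b *\<^sub>R e) \<le> norm e" using b a by (simp add: mult_left_le_one_le)
  then have "norm (y - b *\<^sub>R x - b *\<^sub>R e) < (1 - a) * r"
    using y defect norm_triangle_ineq4[of "y - b *\<^sub>R x" "b *\<^sub>R e"] unfolding e_def by linarith
  also have "\<dots> \<le> (1 - b) * r" using b r0 by (intro mult_right_mono) auto
  finally have "norm (y - b *\<^sub>R x - b *\<^sub>R e) / (1 - b) < r"
    using b1 by (simp add: divide_less_eq mult.commute)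
  then have "norm z < r" using b1 by (simp add: z_def)
  then have "z \<in> ball 0 r" by simp
  then have "z \<in> solution A B k 0 ` controls U"
    using r reach_mono[OF K(2) U(2), of A B] by blast
  then obtain v where v: "v \<in> controls U" "solution A B k 0 v = z" by auto
  define w where "w i = b *\<^sub>R u i + (1 - b) *\<^sub>R v i" for i
  have "w \<in> controls U"
    using u v(1) U(1) b b1 by (auto simp: w_def controls_def intro!: convexD)
  moreover have "solution A B k (b *\<^sub>R x) w = b *\<^sub>R (x + e) + (1 - b) *\<^sub>R z"
    using solution_add[of A B k "b *\<^sub>R x" 0 "\<lambda>i. b *\<^sub>R u i" "\<lambda>i. (1 - b) *\<^sub>R v i"]
      solution_scaleR[of A B k b x u] solution_scaleR[of A B k "1 - b" 0 v] v(2)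
    by (simp add: w_def[abs_def] e_def)
  moreover have "(1 - b) *\<^sub>R z = y - b *\<^sub>R x - b *\<^sub>R e" using b1 by (simp add: z_def)
  then have "b *\<^sub>R (x + e) + (1 - b) *\<^sub>R z = y" by (simp add: algebra_simps)
  ultimately show ?thesis using K by (intro reachableI[of _ _ k _ w]) auto
qed

text \<open>The segment from 0 to \<open>a *\<^sub>R x\<close> is divided into \<open>N\<close>
  short pieces, and neighbouring division points are reachable from each other in both directions. A
  single near return of \<open>x\<close> serves all pieces.\<close>

lemma scaled_mem_origin_control_set:
  assumes D: "control_set_props A B U D" and x: "x \<in> D"
    and r: "r > 0" "ball 0 r \<subseteq> solution A B K 0 ` controls U" and K: "1 \<le> K"
    and U: "convex U" "0 \<in> U" and a: "0 \<le> a" "a < 1"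
  shows "a *\<^sub>R x \<in> origin_control_set A B U"
proof -
  \<comment> \<open>The reserve is smallest at the end \<open>a *\<^sub>R x\<close>, so this
    tolerance works on the whole segment.\<close>
  define \<delta> where "\<delta> = (1 - a) * r / 2"
  have \<delta>: "\<delta> > 0" using a r by (simp add: \<delta>_def)
  obtain k u where u: "K \<le> k" "u \<in> controls U" "norm (solution A B k x u - x) < \<delta>"
    using near_return[OF D x \<delta> K] .
  \<comment> \<open>\<open>N\<close> is chosen so that one piece of the segment is shorter than
    \<open>\<delta>\<close>.\<close>
  obtain N :: nat where N: "norm (a *\<^sub>R x) / \<delta> < N" using reals_Archimedean2 by blast
  have N0: "real N > 0" using N \<delta> by (smt (verit) divide_nonneg_pos norm_ge_zero)
  define t where "t n = real n / real N * a" for n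
  have step: "t m *\<^sub>R x \<in> reachable A B U (t n *\<^sub>R x)"
    if "n \<le> N" "\<bar>real m - real n\<bar> = 1" for m n
  proof (rule reach_along_segment[OF r(2) K u(1) U u(2) a(2)])
    show "0 \<le> t n" "t n \<le> a"
      using a N0 that(1) mult_left_le_one_le[of a "real n / real N"] by (simp_all add: t_def)
    show "norm (solution A B k x u - x) < (1 - a) * r / 2" using u(3) by (simp add: \<delta>_def)
    have "t m *\<^sub>R x - t n *\<^sub>R x = ((real m - real n) / real N) *\<^sub>R (a *\<^sub>R x)"
      by (simp add: t_def scaleR_left_diff_distrib[symmetric] diff_divide_distrib left_diff_distrib)
    then have "norm (t m *\<^sub>R x - t n *\<^sub>R x) = norm (a *\<^sub>R x) / real N"
      using that(2) by (simp only: norm_scaleR abs_divide) simp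
    also have "\<dots> < \<delta>" using N N0 \<delta> by (simp add: field_simps)
    finally show "norm (t m *\<^sub>R x - t n *\<^sub>R x) < (1 - a) * r / 2" by (simp add: \<delta>_def)
  qed
  have "n \<le> N \<Longrightarrow> t n *\<^sub>R x \<in> reachable A B U 0 \<and> 0 \<in> reachable A B U (t n *\<^sub>R x)" for n
  proof (induction n)
    case 0
    then show ?case using zero_reachable_zero[OF U(2)] by (simp add: t_def)
  next
    case (Suc n)
    then show ?case
      using step[of n "Suc n"] step[of "Suc n" n] by (auto intro: reachable_trans)
  qed
  from this[of N] have "a *\<^sub>R x \<in> reachable A B U 0" "0 \<in> reachable A B U (a *\<^sub>R x)"
    using N0 by (simp_all add: t_def)
  then show ?thesis
    unfolding origin_control_set_def reachable_iff_controllable_to[symmetric]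
    using closure_subset[of "reachable A B U 0"]
    by (simp add: reachable_iff_controllable_to subset_iff)
qed

text \<open>For \<open>a < 1\<close> close to 1 the point \<open>a *\<^sub>R x\<close> is still in
  \<open>D\<close>, because \<open>x\<close> is interior, and it also lies in the origin control
  set. Two control sets that meet are equal.\<close>

lemma control_set_eq_origin:
  assumes D: "control_set A B U D" and int: "interior D \<noteq> {}"
    and r: "r > 0" "ball 0 r \<subseteq> solution A B K 0 ` controls U" and K: "1 \<le> K"
    and U: "convex U" "0 \<in> U"
  shows "D = origin_control_set A B U"
proof -
  obtain x where x: "x \<in> interior D" using int by blast
  have "((\<lambda>a. a *\<^sub>R x) \<longlongrightarrow> 1 *\<^sub>R x) (at_left (1::real))"
    by (intro tendsto_intros)
  then have "\<forall>\<^sub>F a in at_left (1::real). a *\<^sub>R x \<in> interior D"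
    by (rule topological_tendstoD) (use x in auto)
  moreover have "\<forall>\<^sub>F a in at_left (1::real). a \<in> {0<..<1}"
    by (rule eventually_at_left_real) simp
  ultimately have "\<forall>\<^sub>F a in at_left (1::real). a *\<^sub>R x \<in> interior D \<and> a \<in> {0<..<1}"
    by (rule eventually_conj)
  then obtain a where a: "a *\<^sub>R x \<in> interior D" "0 < a" "a < 1"
    using eventually_happens[of _ "at_left (1::real)"] by (auto simp: trivial_limit_at_left_real)
  have "a *\<^sub>R x \<in> origin_control_set A B U"
    using scaled_mem_origin_control_set[OF _ _ r K U, of D x a] D a x interior_subset
    by (auto simp: control_set_def)
  moreover have "a *\<^sub>R x \<in> D" using a(1) interior_subset by blast
  ultimately show ?thesis
    using control_set_eq_if_meet[OF D control_set_origin[OF r K U(2)]] by blast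
qed

theorem theorem18:
  fixes A :: "real^'d^'d" and B :: "real^'m^'d" and U :: "(real^'m) set"
  assumes "invertible A"
    and "convex U" and "compact U" and "0 \<in> interior U" and "U = closure (interior U)"
  shows "((\<exists>!D. control_set A B U D \<and> interior D \<noteq> {}) \<longleftrightarrow> controllable A B) \<and>
    (controllable A B \<longleftrightarrow> rank (kalman_matrix A B) = CARD('d)) \<and>
    (controllable A B \<longrightarrow>
      (\<forall>D. control_set A B U D \<and> interior D \<noteq> {} \<longrightarrow>
        0 \<in> transitivity_set A B U D \<inter> interior D))"
proof -
  have U: "convex U" "0 \<in> U" using assms interior_subset by blast+
  let ?D = "origin_control_set A B U"
  \<comment> \<open>Controllability yields existence, uniqueness and the position of 0 together. For
    the converse, the existence of a control set with interior is enough.\<close>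
  have main: "control_set A B U ?D \<and> 0 \<in> interior ?D \<and> 0 \<in> transitivity_set A B U ?D \<and>
      (\<forall>D. control_set A B U D \<and> interior D \<noteq> {} \<longrightarrow> D = ?D)" if ctrl: "controllable A B"
  proof -
    obtain r where r: "r > 0" "ball 0 r \<subseteq> solution A B CARD('d) 0 ` controls U"
      by (rule ball_subset_reach[OF ctrl[unfolded controllable_iff_reach] assms(4)])
    have K: "1 \<le> CARD('d)" by (simp add: Suc_le_eq)
    note int = origin_control_set_interior[OF r K]
    have "0 \<in> transitivity_set A B U ?D"
      using int interior_subset by (auto simp: transitivity_set_def)
    then show ?thesis
      using int control_set_origin[OF r K U(2)] control_set_eq_origin[OF _ _ r K U] by blast
  qed
  then have "(\<exists>!D. control_set A B U D \<and> interior D \<noteq> {}) \<longleftrightarrow> controllable A B"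
    using controllable_if_control_set by (metis empty_iff)
  moreover have "controllable A B \<longleftrightarrow> rank (kalman_matrix A B) = CARD('d)"
    by (simp add: controllable_iff_reach rank_kalman_iff)
  ultimately show ?thesis using main by blast
qed

end
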